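(* Consider a transit network design $\mathbf z^1$ and assume that the optimal route for trip $r$ under $\mathbf z^1$ includes shuttle trips from origin $or^r$ to hub $m$ and from hub $n$ to destination $de^r$, with a trip time $t^1$. For any network $\mathbf z^2\ge\mathbf z^1$, the time $t^2$ of the optimal route for trip $r$ under $\mathbf z^2$ satisfies $$t^2\le t^1+\frac{1-\theta}{\theta}\,g\left(d_{or^rm}+d_{nde^r}-\min_{h,l\in H}\{d_{or^rh}+d_{lde^r}\}\right).$$
   Context: $N$ is a finite set of nodes, $H\subseteq N$ the set of hubs. Trip $r$ has distinct origin $or^r$ and destination $de^r$ in $N\setminus H$. For $i,j\in N$, $t_{ij}\ge0$ and $d_{ij}\ge0$ are travel time and distance (possibly asymmetric), each satisfying the triangle inequality. $\theta\in(0,1]$, $g\ge0$ is the shuttle cost per mile, $s\ge0$ the average bus waiting time. Put $\gamma^r_{ij}=(1-\theta)g\,d_{ij}+\theta t_{ij}$ and $\tau^r_{hl}=\theta(t_{hl}+s)$. A (network) design is a $\mathbf z\in\{0,1\}^{|H|\times|H|}$ ($z_{hl}=1$ iff the bus leg from $h$ to $l$ is open); $\mathbf z^1\le\mathbf z^2$ means $z^1_{hl}\le z^2_{hl}$ for all $h,l\in H$. Given $\mathbf z$, the optimal route of $r$ is a solution of: lexicographically minimize $\langle b^r,f^r\rangle$ (first $b^r$, then $f^r$) over binary $x^r_{hl}$ ($h,l\in H$) and $y^r_{ij}$ ($(i,j)\in A^r$), with $b^r=\sum\tau^r_{hl}x^r_{hl}+\sum\gamma^r_{ij}y^r_{ij}$,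 $f^r=\sum(t_{hl}+s)x^r_{hl}+\sum t_{ij}y^r_{ij}$, subject to $x^r_{hl}\le z_{hl}$ and unit flow conservation from $or^r$ to $de^r$ over bus legs ($x$) and shuttle legs ($y$). Here $A^r=\{(or^r,h),(h,de^r):h\in H\}\cup\{(or^r,de^r)\}$ (other shuttle arcs are unnecessary by the triangle inequality). A route is either a direct shuttle ride from $or^r$ to $de^r$, or a shuttle from $or^r$ to a hub, bus leg(s) between hubs, and a shuttle from a hub to $de^r$. The (trip) time of the optimal route is the lexicographically optimal value of $f^r$ (unique for given $\mathbf z$). *)

theory Defs
  imports Complex_Main
begin

definition triangle_ineq :: "'v set \<Rightarrow> ('v \<Rightarrow> 'v \<Rightarrow> real) \<Rightarrow> bool" where
  "triangle_ineq N c \<longleftrightarrow> (\<forall>i\<in>N. \<forall>j\<in>N. \<forall>k\<in>N. c i k \<le> c i j + c j k)"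

definition design :: "'v set \<Rightarrow> ('v \<Rightarrow> 'v \<Rightarrow> real) \<Rightarrow> bool" where
  "design H z \<longleftrightarrow> (\<forall>h\<in>H. \<forall>l\<in>H. z h l \<in> {0, 1})"

definition design_le :: "'v set \<Rightarrow> ('v \<Rightarrow> 'v \<Rightarrow> real) \<Rightarrow> ('v \<Rightarrow> 'v \<Rightarrow> real) \<Rightarrow> bool" where
  "design_le H z1 z2 \<longleftrightarrow> (\<forall>h\<in>H. \<forall>l\<in>H. z1 h l \<le> z2 h l)"

text \<open>A trip is given by its origin \<open>a\<close> and its destination \<open>b\<close>.\<close>

definition shuttle_arcs :: "'v set \<Rightarrow> 'v \<Rightarrow> 'v \<Rightarrow> ('v \<times> 'v) set" where
  "shuttle_arcs H a b = {(a, h) |h. h \<in> H} \<union> {(h, b) |h. h \<in> H} \<union> {(a, b)}"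

definition shuttle_weight ::
    "('v \<Rightarrow> 'v \<Rightarrow> real) \<Rightarrow> ('v \<Rightarrow> 'v \<Rightarrow> real) \<Rightarrow> real \<Rightarrow> real \<Rightarrow> 'v \<Rightarrow> 'v \<Rightarrow> real" where
  "shuttle_weight t d \<theta> g i j = (1 - \<theta>) * g * d i j + \<theta> * t i j"

definition bus_weight :: "('v \<Rightarrow> 'v \<Rightarrow> real) \<Rightarrow> real \<Rightarrow> real \<Rightarrow> 'v \<Rightarrow> 'v \<Rightarrow> real" where
  "bus_weight t \<theta> s h l = \<theta> * (t h l + s)"

text \<open>
  In what follows \<open>x h l\<close> is the flow on the bus leg from \<open>h\<close> to \<open>l\<close> and \<open>y i j\<close> the flow on the
  shuttle arc \<open>(i, j)\<close>. Only the values of \<open>x\<close> on \<open>H \<times> H\<close> and of \<open>y\<close> on \<open>shuttle_arcs H a b\<close>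
  matter.
\<close>

definition route_weight ::
    "'v set \<Rightarrow> ('v \<Rightarrow> 'v \<Rightarrow> real) \<Rightarrow> ('v \<Rightarrow> 'v \<Rightarrow> real) \<Rightarrow> real \<Rightarrow> real \<Rightarrow> real \<Rightarrow> 'v \<Rightarrow> 'v
      \<Rightarrow> ('v \<Rightarrow> 'v \<Rightarrow> real) \<Rightarrow> ('v \<Rightarrow> 'v \<Rightarrow> real) \<Rightarrow> real" where
  "route_weight H t d \<theta> g s a b x y =
     (\<Sum>(h, l)\<in>H \<times> H. bus_weight t \<theta> s h l * x h l)
   + (\<Sum>(i, j)\<in>shuttle_arcs H a b. shuttle_weight t d \<theta> g i j * y i j)"

definition route_time ::
    "'v set \<Rightarrow> ('v \<Rightarrow> 'v \<Rightarrow> real) \<Rightarrow> real \<Rightarrow> 'v \<Rightarrow> 'v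
      \<Rightarrow> ('v \<Rightarrow> 'v \<Rightarrow> real) \<Rightarrow> ('v \<Rightarrow> 'v \<Rightarrow> real) \<Rightarrow> real" where
  "route_time H t s a b x y =
     (\<Sum>(h, l)\<in>H \<times> H. (t h l + s) * x h l)
   + (\<Sum>(i, j)\<in>shuttle_arcs H a b. t i j * y i j)"

definition outflow ::
    "'v set \<Rightarrow> 'v \<Rightarrow> 'v \<Rightarrow> ('v \<Rightarrow> 'v \<Rightarrow> real) \<Rightarrow> ('v \<Rightarrow> 'v \<Rightarrow> real) \<Rightarrow> 'v \<Rightarrow> real" where
  "outflow H a b x y i =
     (\<Sum>(h, l)\<in>{e \<in> H \<times> H. fst e = i}. x h l)
   + (\<Sum>(j, k)\<in>{e \<in> shuttle_arcs H a b. fst e = i}. y j k)"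

definition inflow ::
    "'v set \<Rightarrow> 'v \<Rightarrow> 'v \<Rightarrow> ('v \<Rightarrow> 'v \<Rightarrow> real) \<Rightarrow> ('v \<Rightarrow> 'v \<Rightarrow> real) \<Rightarrow> 'v \<Rightarrow> real" where
  "inflow H a b x y i =
     (\<Sum>(h, l)\<in>{e \<in> H \<times> H. snd e = i}. x h l)
   + (\<Sum>(j, k)\<in>{e \<in> shuttle_arcs H a b. snd e = i}. y j k)"

definition feasible_route ::
    "'v set \<Rightarrow> 'v set \<Rightarrow> 'v \<Rightarrow> 'v \<Rightarrow> ('v \<Rightarrow> 'v \<Rightarrow> real)
      \<Rightarrow> ('v \<Rightarrow> 'v \<Rightarrow> real) \<Rightarrow> ('v \<Rightarrow> 'v \<Rightarrow> real) \<Rightarrow> bool" where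
  "feasible_route N H a b z x y \<longleftrightarrow>
     (\<forall>h\<in>H. \<forall>l\<in>H. x h l \<in> {0, 1} \<and> x h l \<le> z h l) \<and>
     (\<forall>(i, j)\<in>shuttle_arcs H a b. y i j \<in> {0, 1}) \<and>
     (\<forall>i\<in>N. outflow H a b x y i - inflow H a b x y i =
              (if i = a then 1 else if i = b then -1 else 0))"

definition optimal_route ::
    "'v set \<Rightarrow> 'v set \<Rightarrow> ('v \<Rightarrow> 'v \<Rightarrow> real) \<Rightarrow> ('v \<Rightarrow> 'v \<Rightarrow> real) \<Rightarrow> real \<Rightarrow> real \<Rightarrow> real
      \<Rightarrow> 'v \<Rightarrow> 'v \<Rightarrow> ('v \<Rightarrow> 'v \<Rightarrow> real)
      \<Rightarrow> ('v \<Rightarrow> 'v \<Rightarrow> real) \<Rightarrow> ('v \<Rightarrow> 'v \<Rightarrow> real) \<Rightarrow> bool" where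
  "optimal_route N H t d \<theta> g s a b z x y \<longleftrightarrow>
     feasible_route N H a b z x y \<and>
     (\<forall>x' y'. feasible_route N H a b z x' y' \<longrightarrow>
        route_weight H t d \<theta> g s a b x y < route_weight H t d \<theta> g s a b x' y' \<or>
        route_weight H t d \<theta> g s a b x y = route_weight H t d \<theta> g s a b x' y' \<and>
        route_time H t s a b x y \<le> route_time H t s a b x' y')"

text \<open>Existence and uniqueness of the value below are shown in \<open>ex1_trip_time\<close>.\<close>

definition trip_time ::
    "'v set \<Rightarrow> 'v set \<Rightarrow> ('v \<Rightarrow> 'v \<Rightarrow> real) \<Rightarrow> ('v \<Rightarrow> 'v \<Rightarrow> real) \<Rightarrow> real \<Rightarrow> real \<Rightarrow> real
      \<Rightarrow> 'v \<Rightarrow> 'v \<Rightarrow> ('v \<Rightarrow> 'v \<Rightarrow> real) \<Rightarrow> real" where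
  "trip_time N H t d \<theta> g s a b z =
     (THE f. \<exists>x y. optimal_route N H t d \<theta> g s a b z x y \<and> f = route_time H t s a b x y)"

lemma finite_shuttle_arcs: "finite H \<Longrightarrow> finite (shuttle_arcs H a b)"
  by (simp add: shuttle_arcs_def)

lemma feasible_direct:
  assumes "finite H" "a \<noteq> b" "design H z"
  shows "feasible_route N H a b z (\<lambda>_ _. 0) (\<lambda>i j. if i = a \<and> j = b then 1 else 0)"
proof -
  let ?y = "\<lambda>i j. if i = a \<and> j = b then 1 else (0::real)"
  have y: "(\<Sum>(j, k)\<in>S. ?y j k) = (if (a, b) \<in> S then 1 else 0)" if "finite S" for S
  proof -
    have "(\<Sum>(j, k)\<in>S. ?y j k) = (\<Sum>e\<in>S. if e = (a, b) then 1 else 0)"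
      by (intro sum.cong) (auto split: if_splits)
    then show ?thesis using that by simp
  qed
  have "(a, b) \<in> shuttle_arcs H a b"
    by (simp add: shuttle_arcs_def)
  then show ?thesis
    using assms
    by (fastforce simp: feasible_route_def outflow_def inflow_def design_def y finite_shuttle_arcs)
qed

lemma finite_objective_values:
  assumes "finite H"
  shows "finite {(route_weight H t d \<theta> g s a b x y, route_time H t s a b x y) |x y.
                  feasible_route N H a b z x y}"
proof -
  let ?A = "shuttle_arcs H a b"
  let ?X = "Pow (H \<times> H) \<times> Pow ?A"
  let ?x = "\<lambda>P h l. if (h, l) \<in> P then 1 else (0::real)"
  let ?F = "\<lambda>(P, Q). (route_weight H t d \<theta> g s a b (?x P) (?x Q),
                      route_time H t s a b (?x P) (?x Q))"
  have "(route_weight H t d \<theta> g s a b x y, route_time H t s a b x y) \<in> ?F ` ?X"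
    if f: "feasible_route N H a b z x y" for x y
  proof -
    let ?P = "{(h, l) \<in> H \<times> H. x h l = 1}"
    let ?Q = "{(i, j) \<in> ?A. y i j = 1}"
    have x: "x h l = ?x ?P h l" if "h \<in> H" "l \<in> H" for h l
      using f that by (force simp: feasible_route_def)
    have y: "y i j = ?x ?Q i j" if "(i, j) \<in> ?A" for i j
      using f that by (fastforce simp: feasible_route_def)
    have "route_weight H t d \<theta> g s a b x y = route_weight H t d \<theta> g s a b (?x ?P) (?x ?Q)"
      unfolding route_weight_def
      by (intro arg_cong2[where f = "(+)"] sum.cong refl) (use x y in \<open>force+\<close>)
    moreover have "route_time H t s a b x y = route_time H t s a b (?x ?P) (?x ?Q)"
      unfolding route_time_def
      by (intro arg_cong2[where f = "(+)"] sum.cong refl) (use x y in \<open>force+\<close>)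
    ultimately show ?thesis
      by (intro image_eqI[of _ _ "(?P, ?Q)"]) auto
  qed
  then have "{(route_weight H t d \<theta> g s a b x y, route_time H t s a b x y) |x y.
                feasible_route N H a b z x y} \<subseteq> ?F ` ?X"
    by blast
  moreover have "finite (?F ` ?X)"
    using assms by (simp add: finite_shuttle_arcs)
  ultimately show ?thesis
    by (rule finite_subset)
qed

lemma ex_lex_min:
  fixes V :: "(real \<times> real) set"
  assumes "finite V" "V \<noteq> {}"
  shows "\<exists>u v. (u, v) \<in> V \<and> (\<forall>u' v'. (u', v') \<in> V \<longrightarrow> u < u' \<or> u = u' \<and> v \<le> v')"
proof -
  define u where "u = Min (fst ` V)"
  define W where "W = {v. (u, v) \<in> V}"
  have "u \<in> fst ` V"
    unfolding u_def using assms by (intro Min_in) auto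
  then have "W \<noteq> {}" by (auto simp: W_def)
  have "W \<subseteq> snd ` V" by (force simp: W_def)
  then have "finite W" using assms(1) finite_surj by blast
  then have "Min W \<in> W" using \<open>W \<noteq> {}\<close> by simp
  then have "(u, Min W) \<in> V" by (simp add: W_def)
  moreover have "u < u' \<or> u = u' \<and> Min W \<le> v'" if "(u', v') \<in> V" for u' v'
  proof -
    have "u \<le> u'" unfolding u_def using assms(1) that by (force intro: Min_le)
    moreover have "Min W \<le> v'" if "u = u'"
      using \<open>(u', v') \<in> V\<close> that \<open>finite W\<close> by (auto simp: W_def)
    ultimately show ?thesis by linarith
  qed
  ultimately show ?thesis by blast
qed

lemma ex1_trip_time:
  assumes "finite H" "a \<noteq> b" "design H z"
  shows "\<exists>!f. \<exists>x y. optimal_route N H t d \<theta> g s a b z x y \<and> f = route_time H t s a b x y"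
proof -
  let ?V = "{(route_weight H t d \<theta> g s a b x y, route_time H t s a b x y) |x y.
              feasible_route N H a b z x y}"
  have "?V \<noteq> {}"
    using feasible_direct[OF assms] by blast
  from ex_lex_min[OF finite_objective_values[OF assms(1)] this]
  obtain u v where uv: "(u, v) \<in> ?V"
    and min: "\<And>u' v'. (u', v') \<in> ?V \<Longrightarrow> u < u' \<or> u = u' \<and> v \<le> v'"
    by blast
  from uv obtain x y where "feasible_route N H a b z x y"
    "u = route_weight H t d \<theta> g s a b x y" "v = route_time H t s a b x y"
    by blast
  then have "optimal_route N H t d \<theta> g s a b z x y"
    unfolding optimal_route_def using min by blast
  moreover have "route_time H t s a b x y = route_time H t s a b x' y'"
    if "optimal_route N H t d \<theta> g s a b z x y" "optimal_route N H t d \<theta> g s a b z x' y'"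
    for x y x' y'
    using that unfolding optimal_route_def by (metis less_asym less_irrefl order_antisym)
  ultimately show ?thesis
    by blast
qed

end

theory Submission
  imports Defs
begin

text \<open>
  The weight of a route is \<open>\<theta>\<close> times its time plus \<open>(1 - \<theta>) g\<close> times its shuttle distance.
  Since the route for \<open>z1\<close> remains available under \<open>z2\<close>, the optimal weight does not increase,
  so the time can only grow by as much as the shuttle distance shrinks. The shuttle distance of a
  route through hubs is at least the minimum in the statement. The direct ride may be shorter
  than this minimum, but if it is optimal under \<open>z2\<close>, it has the same weight as the optimal route
  under \<open>z1\<close>, where it was available as well, and then the trip times agree.
\<close>

text \<open>The cost \<open>d\<close> is a parameter because the sum is needed for travel times as
  well: with \<open>t\<close> in its place it is the shuttle part of
  \<open>route_time\<close>.\<close>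

definition shuttle_distance ::
    "'v set \<Rightarrow> ('v \<Rightarrow> 'v \<Rightarrow> real) \<Rightarrow> 'v \<Rightarrow> 'v \<Rightarrow> ('v \<Rightarrow> 'v \<Rightarrow> real) \<Rightarrow> real" where
  "shuttle_distance H d a b y = (\<Sum>(i, j)\<in>shuttle_arcs H a b. d i j * y i j)"

lemma route_weight_eq:
  "route_weight H t d \<theta> g s a b x y
     = \<theta> * route_time H t s a b x y + (1 - \<theta>) * g * shuttle_distance H d a b y"
  unfolding route_weight_def route_time_def shuttle_distance_def bus_weight_def shuttle_weight_def
  by (simp add: sum_distrib_left distrib_left distrib_right sum.distrib case_prod_unfold mult.assoc)

text \<open>The design enters feasibility only as an upper bound on the bus flow
  \<open>x\<close>.\<close>

lemma feasible_route_mono: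
  assumes "feasible_route N H a b z1 x y" "design_le H z1 z2"
  shows "feasible_route N H a b z2 x y"
  using assms unfolding feasible_route_def design_le_def by (meson order_trans)

lemma trip_time_eq:
  assumes "finite H" "a \<noteq> b" "design H z" "optimal_route N H t d \<theta> g s a b z x y"
  shows "trip_time N H t d \<theta> g s a b z = route_time H t s a b x y"
  unfolding trip_time_def using ex1_trip_time[OF assms(1-3)] assms(4) by (intro the1_equality) blast+

text \<open>As neither \<open>a\<close> nor \<open>b\<close> is a hub, the direct arc, the arcs from
  \<open>a\<close> to hubs and the arcs from hubs to \<open>b\<close> are pairwise disjoint
  families.\<close>

lemma sum_shuttle_arcs:
  assumes "finite H" "a \<notin> H" "b \<notin> H"
  shows "(\<Sum>(i, j)\<in>shuttle_arcs H a b. f i j)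
           = (f a b :: real) + (\<Sum>h\<in>H. f a h) + (\<Sum>h\<in>H. f h b)"
proof -
  have "shuttle_arcs H a b = insert (a, b) (Pair a ` H \<union> (\<lambda>h. (h, b)) ` H)"
    by (auto simp: shuttle_arcs_def)
  moreover have "(\<Sum>(i, j)\<in>insert (a, b) (Pair a ` H \<union> (\<lambda>h. (h, b)) ` H). f i j)
      = f a b + (\<Sum>(i, j)\<in>Pair a ` H \<union> (\<lambda>h. (h, b)) ` H. f i j)"
    using assms by (subst sum.insert) auto
  moreover have "(\<Sum>(i, j)\<in>Pair a ` H \<union> (\<lambda>h. (h, b)) ` H. f i j)
      = (\<Sum>(i, j)\<in>Pair a ` H. f i j) + (\<Sum>(i, j)\<in>(\<lambda>h. (h, b)) ` H. f i j)"
    using assms by (intro sum.union_disjoint) auto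
  ultimately show ?thesis
    by (simp add: sum.reindex inj_on_def)
qed

text \<open>No bus leg touches \<open>a\<close> and no shuttle arc enters it, so flow conservation
  at \<open>a\<close> only counts the shuttle arcs that leave it.\<close>

lemma feasible_origin_sum:
  assumes "feasible_route N H a b z x y" "finite H" "a \<in> N - H" "b \<notin> H" "a \<noteq> b"
  shows "(\<Sum>k\<in>insert b H. y a k) = 1"
proof -
  have "{e \<in> shuttle_arcs H a b. fst e = a} = Pair a ` insert b H"
    and "{e \<in> H \<times> H. fst e = a} = {}" "{e \<in> H \<times> H. snd e = a} = {}"
    and "{e \<in> shuttle_arcs H a b. snd e = a} = {}"
    using assms by (auto simp: shuttle_arcs_def)
  then have "outflow H a b x y a - inflow H a b x y a = (\<Sum>k\<in>insert b H. y a k)"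
    unfolding outflow_def inflow_def by (simp only:) (simp add: sum.reindex inj_on_def del: image_insert sum.insert)
  then show ?thesis
    using assms by (auto simp: feasible_route_def)
qed

lemma feasible_destination_sum:
  assumes "feasible_route N H a b z x y" "finite H" "b \<in> N - H" "a \<notin> H" "a \<noteq> b"
  shows "(\<Sum>k\<in>insert a H. y k b) = 1"
proof -
  have "{e \<in> shuttle_arcs H a b. snd e = b} = (\<lambda>k. (k, b)) ` insert a H"
    and "{e \<in> H \<times> H. fst e = b} = {}" "{e \<in> H \<times> H. snd e = b} = {}"
    and "{e \<in> shuttle_arcs H a b. fst e = b} = {}"
    using assms by (auto simp: shuttle_arcs_def)
  then have "outflow H a b x y b - inflow H a b x y b = - (\<Sum>k\<in>insert a H. y k b)"
    unfolding outflow_def inflow_def by (simp only:) (simp add: sum.reindex inj_on_def del: image_insert sum.insert)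
  then show ?thesis
    using assms by (auto simp: feasible_route_def)
qed

lemma binary_sum_eq_1:
  fixes f :: "'a \<Rightarrow> real"
  assumes "finite S" "\<And>k. k \<in> S \<Longrightarrow> f k \<in> {0, 1}" "sum f S = 1"
  obtains k where "k \<in> S" "\<And>i. i \<in> S \<Longrightarrow> f i = (if i = k then 1 else 0)"
proof -
  obtain k where k: "k \<in> S" "f k = 1"
    using assms by (metis empty_iff insert_iff sum.neutral zero_neq_one)
  have "sum f (S - {k}) = 0"
    using sum.remove[OF assms(1) k(1), of f] assms(3) k(2) by simp
  moreover have "\<forall>i\<in>S - {k}. 0 \<le> f i"
    using assms(2) by force
  ultimately have "\<forall>i\<in>S - {k}. f i = 0"
    using assms(1) sum_nonneg_eq_0_iff[of "S - {k}" f] by blast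
  then show ?thesis using k that by auto
qed

text \<open>Conservation at the two ends suffices: exactly one used shuttle arc leaves
  \<open>a\<close> and exactly one enters \<open>b\<close>. Every shuttle arc is of one of these two
  kinds, so this fixes \<open>y\<close> on all arcs, and with it the shuttle sum for any cost
  \<open>c\<close>. Nothing is claimed about the bus flow.\<close>

lemma feasible_route_cases:
  assumes f: "feasible_route N H a b z x y" and "finite H" "a \<in> N - H" "b \<in> N - H" "a \<noteq> b"
  obtains (direct) "y a b = 1" "\<And>h. h \<in> H \<Longrightarrow> y a h = 0" "\<And>h. h \<in> H \<Longrightarrow> y h b = 0"
      "\<And>c. shuttle_distance H c a b y = c a b"
  | (hubs) h l where "h \<in> H" "l \<in> H" "y a b = 0"
      "\<And>k. k \<in> H \<Longrightarrow> y a k = (if k = h then 1 else 0)"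
      "\<And>k. k \<in> H \<Longrightarrow> y k b = (if k = l then 1 else 0)"
      "\<And>c. shuttle_distance H c a b y = c a h + c l b"
proof -
  have bin: "y i j \<in> {0, 1}" if "(i, j) \<in> shuttle_arcs H a b" for i j
    using f that by (auto simp: feasible_route_def)
  obtain h where h: "h \<in> insert b H" "\<And>k. k \<in> insert b H \<Longrightarrow> y a k = (if k = h then 1 else 0)"
  proof (rule binary_sum_eq_1)
    show "sum (y a) (insert b H) = 1"
      using feasible_origin_sum[OF f] assms by blast
    show "y a k \<in> {0, 1}" if "k \<in> insert b H" for k
      using that by (intro bin) (auto simp: shuttle_arcs_def)
  qed (use assms in auto)
  obtain l where l: "l \<in> insert a H" "\<And>k. k \<in> insert a H \<Longrightarrow> y k b = (if k = l then 1 else 0)"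
  proof (rule binary_sum_eq_1)
    show "(\<Sum>k\<in>insert a H. y k b) = 1"
      using feasible_destination_sum[OF f] assms by blast
    show "y k b \<in> {0, 1}" if "k \<in> insert a H" for k
      using that by (intro bin) (auto simp: shuttle_arcs_def)
  qed (use assms in auto)
  \<comment> \<open>The arc \<open>(a, b)\<close> belongs to both families, so both descriptions
    must agree on \<open>y a b\<close>.\<close>
  have hl: "h = b \<longleftrightarrow> l = a"
    using h(2)[of b] l(2)[of a] by (auto split: if_splits)
  have sd: "shuttle_distance H c a b y
      = c a b * y a b + (\<Sum>k\<in>H. c a k * y a k) + (\<Sum>k\<in>H. c k b * y k b)" for c
    unfolding shuttle_distance_def using assms by (intro sum_shuttle_arcs) auto
  show ?thesis
  proof (cases "h = b")
    case True
    then have y0: "y a b = 1" "\<And>k. k \<in> H \<Longrightarrow> y a k = 0" "\<And>k. k \<in> H \<Longrightarrow> y k b = 0"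
      using h(2) l(2) hl assms by auto
    then show ?thesis
      using direct by (simp add: sd)
  next
    case False
    then have "h \<in> H" "l \<in> H" "y a b = 0"
      using h l hl by auto
    moreover have "(\<Sum>k\<in>H. c a k * y a k) = c a h" "(\<Sum>k\<in>H. c k b * y k b) = c l b" for c
    proof -
      have "(\<Sum>k\<in>H. c a k * y a k) = (\<Sum>k\<in>H. if k = h then c a k else 0)"
        using h(2) by (intro sum.cong) auto
      then show "(\<Sum>k\<in>H. c a k * y a k) = c a h"
        using \<open>h \<in> H\<close> \<open>finite H\<close> by simp
      have "(\<Sum>k\<in>H. c k b * y k b) = (\<Sum>k\<in>H. if k = l then c k b else 0)"
        using l(2) by (intro sum.cong) auto
      then show "(\<Sum>k\<in>H. c k b * y k b) = c l b"
        using \<open>l \<in> H\<close> \<open>finite H\<close> by simp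
    qed
    ultimately show ?thesis
      using hubs[of h l] h(2) l(2) by (simp add: sd)
  qed
qed

theorem proposition3:
  fixes N H :: "'v set"
    and t d :: "'v \<Rightarrow> 'v \<Rightarrow> real"
    and \<theta> g s :: real
    and a b m n :: 'v
    and z1 z2 x y :: "'v \<Rightarrow> 'v \<Rightarrow> real"
    and t1 t2 :: real
  assumes "finite N" and "H \<subseteq> N"
    and "a \<in> N - H" and "b \<in> N - H" and "a \<noteq> b"
    and "\<And>i j. i \<in> N \<Longrightarrow> j \<in> N \<Longrightarrow> t i j \<ge> 0"
    and "\<And>i j. i \<in> N \<Longrightarrow> j \<in> N \<Longrightarrow> d i j \<ge> 0"
    and "triangle_ineq N t" and "triangle_ineq N d"
    and "0 < \<theta>" and "\<theta> \<le> 1" and "g \<ge> 0" and "s \<ge> 0"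
    and "design H z1" and "design H z2" and "design_le H z1 z2"
    and "optimal_route N H t d \<theta> g s a b z1 x y"
    and "m \<in> H" and "y a m = 1"
    and "n \<in> H" and "y n b = 1"
    and "t1 = trip_time N H t d \<theta> g s a b z1"
    and "t2 = trip_time N H t d \<theta> g s a b z2"
  shows "t2 \<le> t1 + (1 - \<theta>) / \<theta> * g * (d a m + d n b - Min {d a h + d l b |h l. h \<in> H \<and> l \<in> H})"
proof -
  let ?W = "route_weight H t d \<theta> g s a b" and ?T = "route_time H t s a b"
  let ?M = "Min {d a h + d l b |h l. h \<in> H \<and> l \<in> H}"
  have fin: "finite H"
    using \<open>finite N\<close> \<open>H \<subseteq> N\<close> by (rule rev_finite_subset)
  have min_le: "?M \<le> d a h + d l b" if "h \<in> H" "l \<in> H" for h l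
  proof (rule Min_le)
    have "{d a h + d l b |h l. h \<in> H \<and> l \<in> H} = (\<lambda>(h, l). d a h + d l b) ` (H \<times> H)"
      by auto
    then show "finite {d a h + d l b |h l. h \<in> H \<and> l \<in> H}"
      using fin by simp
  qed (use that in blast)
  note o1 = \<open>optimal_route N H t d \<theta> g s a b z1 x y\<close>
  then have f1: "feasible_route N H a b z1 x y"
    by (simp add: optimal_route_def)
  obtain x' y' where o2: "optimal_route N H t d \<theta> g s a b z2 x' y'"
    using ex1_trip_time[OF fin \<open>a \<noteq> b\<close> \<open>design H z2\<close>] by blast
  then have f2: "feasible_route N H a b z2 x' y'"
    by (simp add: optimal_route_def)
  have t1: "t1 = ?T x y"
    using assms(22) trip_time_eq[OF fin \<open>a \<noteq> b\<close> \<open>design H z1\<close> o1] by simp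
  have t2: "t2 = ?T x' y'"
    using assms(23) trip_time_eq[OF fin \<open>a \<noteq> b\<close> \<open>design H z2\<close> o2] by simp
  have lex: "?W x' y' < ?W x y \<or> ?W x' y' = ?W x y \<and> t2 \<le> t1"
    using o2 feasible_route_mono[OF f1 \<open>design_le H z1 z2\<close>] by (simp add: optimal_route_def t1 t2)
  \<comment> \<open>The used arc to \<open>m\<close> excludes the direct ride, and uniqueness of the
    used arcs identifies \<open>m\<close> and \<open>n\<close> with the two hubs of the case
    analysis.\<close>
  have D1: "shuttle_distance H d a b y = d a m + d n b"
    using f1 fin \<open>a \<in> N - H\<close> \<open>b \<in> N - H\<close> \<open>a \<noteq> b\<close>
  proof (cases rule: feasible_route_cases)
    case direct
    then show ?thesis using \<open>m \<in> H\<close> \<open>y a m = 1\<close> by simp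
  next
    case (hubs h l)
    then have "m = h" "n = l"
      using \<open>m \<in> H\<close> \<open>y a m = 1\<close> \<open>n \<in> H\<close> \<open>y n b = 1\<close> by (metis zero_neq_one)+
    then show ?thesis using hubs by simp
  qed
  show ?thesis
    using f2 fin \<open>a \<in> N - H\<close> \<open>b \<in> N - H\<close> \<open>a \<noteq> b\<close>
  proof (cases rule: feasible_route_cases)
    case direct
    \<comment> \<open>Here \<open>x'\<close> may still carry circulations on bus legs that are
      closed under \<open>z1\<close>, so the route itself cannot be moved to \<open>z1\<close>. Its
      version with zero bus flow can, and bus legs have nonnegative time, so nothing is
      lost.\<close>
    let ?y = "\<lambda>i j. if i = a \<and> j = b then 1 else (0 :: real)"
    have f0: "feasible_route N H a b z1 (\<lambda>_ _. 0) ?y"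
      using fin \<open>a \<noteq> b\<close> \<open>design H z1\<close> by (rule feasible_direct)
    then have D0: "shuttle_distance H c a b ?y = c a b" for c
      using fin \<open>a \<in> N - H\<close> \<open>b \<in> N - H\<close> \<open>a \<noteq> b\<close> by (cases rule: feasible_route_cases) auto
    have "?T (\<lambda>_ _. 0) ?y \<le> ?T x' y'"
    proof -
      have "0 \<le> (t h l + s) * x' h l" if "h \<in> H" "l \<in> H" for h l
      proof (rule mult_nonneg_nonneg)
        show "0 \<le> t h l + s"
          using that \<open>H \<subseteq> N\<close> by (intro add_nonneg_nonneg assms(6) \<open>s \<ge> 0\<close>) auto
        have "x' h l \<in> {0, 1}"
          using f2 that by (simp add: feasible_route_def)
        then show "0 \<le> x' h l" by auto
      qed
      then have "0 \<le> (\<Sum>(h, l)\<in>H \<times> H. (t h l + s) * x' h l)"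
        by (intro sum_nonneg) auto
      then show ?thesis
        by (simp add: route_time_def D0 direct flip: shuttle_distance_def)
    qed
    then have "?W (\<lambda>_ _. 0) ?y \<le> ?W x' y'"
      using \<open>0 < \<theta>\<close> by (simp add: route_weight_eq D0 direct)
    moreover have "?W x y \<le> ?W (\<lambda>_ _. 0) ?y"
      using o1 f0 unfolding optimal_route_def by (metis less_imp_le order_refl)
    ultimately have "?W x y \<le> ?W x' y'"
      by simp
    \<comment> \<open>The weights are tied, so the lexicographic second criterion decides.\<close>
    then have "t2 \<le> t1"
      using lex by simp
    \<comment> \<open>The pair \<open>(m, n)\<close> is itself a candidate in the minimum.\<close>
    moreover have "0 \<le> (1 - \<theta>) / \<theta> * g * (d a m + d n b - ?M)"
      using assms min_le[OF \<open>m \<in> H\<close> \<open>n \<in> H\<close>] by simp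
    ultimately show ?thesis by linarith
  next
    case (hubs h l)
    have "?W x' y' \<le> ?W x y"
      using lex by auto
    \<comment> \<open>The weight inequality, split into time and shuttle distance on both sides;
      bounding \<open>d a h + d l b\<close> below by the minimum and dividing by
      \<open>\<theta>\<close> then gives the claim.\<close>
    then have "\<theta> * t2 + (1 - \<theta>) * g * (d a h + d l b) \<le> \<theta> * t1 + (1 - \<theta>) * g * (d a m + d n b)"
      by (simp add: route_weight_eq t1 t2 D1 hubs)
    moreover have "(1 - \<theta>) * g * ?M \<le> (1 - \<theta>) * g * (d a h + d l b)"
      using assms min_le hubs by (intro mult_left_mono) auto
    ultimately have "\<theta> * t2 \<le> \<theta> * t1 + (1 - \<theta>) * g * (d a m + d n b - ?M)"
      by (simp add: right_diff_distrib)
    then show ?thesis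
      using \<open>0 < \<theta>\<close> by (simp add: field_simps)
  qed
qed

end
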